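(* Let $G$ be a finite, simple, undirected graph. Then $\gamma_{r2}(G)\leq 2\gamma_r(G)$. Furthermore, if $\gamma_{r2}(G)=2\gamma_r(G)$ and $g:V(G)\to\{0,1,2\}$ is a minimum weak Roman dominating function of $G$, then (i) there is no vertex $x$ of $G$ with $g(x)=2$, and (ii) if $V_1=\{v_1,\ldots,v_k\}$ (with $v_1,\ldots,v_k$ distinct) is the set of vertices $x$ of $G$ with $g(x)=1$, then $V(G)\setminus V_1$ has a partition into $2k$ sets $P_1,\ldots,P_k,Q_1,\ldots,Q_k$ such that for every $i\in[k]$: (a) $P_i=\{u\in V(G)\setminus V_1: N_G(u)\cap V_1=\{v_i\}\}$, and $P_i$ is non-empty and complete, and (b) every vertex in the possibly empty set $Q_i$ is adjacent to every vertex in $\{v_i\}\cup P_i$.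
   Context: All graphs are finite, simple, and undirected. $N_G(u)$ denotes the set of neighbors of $u$ in $G$ (not including $u$), and $[k]=\{1,\ldots,k\}$. A set of vertices is complete if its vertices are pairwise adjacent. In the partition, the sets are pairwise disjoint with union $V(G)\setminus V_1$, and the sets $Q_i$ are allowed to be empty. A $2$-rainbow dominating function of a graph $G$ is a function $f:V(G)\to 2^{\{1,2\}}$ (values are subsets of $\{1,2\}$) such that $\bigcup_{v\in N_G(u)}f(v)=\{1,2\}$ for every vertex $u$ of $G$ with $f(u)=\emptyset$. Its weight is $\sum_{u\in V(G)}|f(u)|$. The $2$-rainbow domination number $\gamma_{r2}(G)$ is the minimum weight of a $2$-rainbow dominating function of $G$. A set $D$ of vertices of $G$ is dominating if every vertex in $V(G)\setminus D$ has a neighbor in $D$. For a function $g:V(G)\to\mathbb{R}$ and two distinct vertices $u,v$ of $G$, let $g_{v\to u}:V(G)\to\mathbb{R}$ be the function with $g_{v\to u}(u)=g(u)+1$, $g_{v\to u}(v)=g(v)-1$, and $g_{v\to u}(x)=g(x)$ for $x\in V(G)\setminus\{u,v\}$. A weak Roman dominating function of $G$ is a function $g:V(G)\to\{0,1,2\}$ such that every vertex $u$ of $G$ with $g(u)=0$ has a neighbor $v$ with $g(v)\geq 1$ such that the set $\{x\in V(G): g_{v\to u}(x)\geq 1\}$ is dominating. Its weight is $\sum_{u\in V(G)}g(u)$. The weak Roman domination number $\gamma_r(G)$ is the minimum weight of a weak Roman dominating function of $G$, and a weak Roman dominating function of weight $\gamma_r(G)$ is called minimum. *)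

theory Defs
  imports Complex_Main "HOL-Library.FuncSet" "HOL-Library.Disjoint_Sets"
    "Graph_Theory.Pair_Digraph"
begin

(* A finite simple undirected graph is a pair_graph: finitely many vertices, and an
   irreflexive, symmetric set of arcs, so an edge uv is the pair of arcs (u,v), (v,u).
   The null graph is allowed.
   Functions on the vertices are total on the type; their values off pverts G are never
   looked at. *)

definition neighbors :: "'a pair_pre_digraph \<Rightarrow> 'a \<Rightarrow> 'a set" where
  "neighbors G u = {v \<in> pverts G. (u, v) \<in> parcs G}"

definition complete_set :: "'a pair_pre_digraph \<Rightarrow> 'a set \<Rightarrow> bool" where
  "complete_set G S \<longleftrightarrow> pairwise (\<lambda>u v. v \<in> neighbors G u) S"

definition dominating_set :: "'a pair_pre_digraph \<Rightarrow> 'a set \<Rightarrow> bool" where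
  "dominating_set G D \<longleftrightarrow>
     D \<subseteq> pverts G \<and> (\<forall>u \<in> pverts G - D. neighbors G u \<inter> D \<noteq> {})"

definition rainbow2_dominating :: "'a pair_pre_digraph \<Rightarrow> ('a \<Rightarrow> nat set) \<Rightarrow> bool" where
  "rainbow2_dominating G f \<longleftrightarrow>
     f \<in> pverts G \<rightarrow> Pow {1, 2} \<and>
     (\<forall>u \<in> pverts G. f u = {} \<longrightarrow> (\<Union>v \<in> neighbors G u. f v) = {1, 2})"

definition rainbow_weight :: "'a pair_pre_digraph \<Rightarrow> ('a \<Rightarrow> nat set) \<Rightarrow> nat" where
  "rainbow_weight G f = (\<Sum>u \<in> pverts G. card (f u))"

(* On finite graphs the constant function {1,2} is 2-rainbow dominating, so the LEAST is
   attained; likewise for the constant 2 and weak_roman_number below. *)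
definition rainbow2_domination_number :: "'a pair_pre_digraph \<Rightarrow> nat" where
  "rainbow2_domination_number G =
     (LEAST w. \<exists>f. rainbow2_dominating G f \<and> rainbow_weight G f = w)"

(* shift g v u moves one unit from v to u; it is meant for distinct u and v. *)
definition shift :: "('a \<Rightarrow> real) \<Rightarrow> 'a \<Rightarrow> 'a \<Rightarrow> 'a \<Rightarrow> real" where
  "shift g v u = g(u := g u + 1, v := g v - 1)"

definition weak_roman_dominating :: "'a pair_pre_digraph \<Rightarrow> ('a \<Rightarrow> nat) \<Rightarrow> bool" where
  "weak_roman_dominating G g \<longleftrightarrow>
     g \<in> pverts G \<rightarrow> {0, 1, 2} \<and>
     (\<forall>u \<in> pverts G. g u = 0 \<longrightarrow>
        (\<exists>v \<in> neighbors G u. g v \<ge> 1 \<and>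
           dominating_set G {x \<in> pverts G. shift (\<lambda>y. real (g y)) v u x \<ge> 1}))"

definition weak_roman_weight :: "'a pair_pre_digraph \<Rightarrow> ('a \<Rightarrow> nat) \<Rightarrow> nat" where
  "weak_roman_weight G g = (\<Sum>u \<in> pverts G. g u)"

definition weak_roman_number :: "'a pair_pre_digraph \<Rightarrow> nat" where
  "weak_roman_number G =
     (LEAST w. \<exists>g. weak_roman_dominating G g \<and> weak_roman_weight G g = w)"

definition minimum_weak_roman_dominating :: "'a pair_pre_digraph \<Rightarrow> ('a \<Rightarrow> nat) \<Rightarrow> bool" where
  "minimum_weak_roman_dominating G g \<longleftrightarrow>
     weak_roman_dominating G g \<and> weak_roman_weight G g = weak_roman_number G"

end

theory Submission
  imports Defs
begin

text \<open>
  Call the vertices with a positive value under a weak Roman dominating function \<open>g\<close> the guarded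
  ones. They form a dominating set \<open>D\<close>, so giving both colours to each of them is 2-rainbow
  dominating (\<open>rainbow_number_le_twice_card\<close>). This costs \<open>2 * card D\<close>, which is at most twice
  the weight of \<open>g\<close>, and the inequality follows.

  Equality leaves no slack in this estimate. A value 2 makes \<open>card D\<close> smaller than the weight of
  \<open>g\<close>, which gives (i). With all positive values equal to 1, suppose that some \<open>w \<in> D\<close> had no private
  neighbour, that is, no vertex outside \<open>D\<close> whose only neighbour in \<open>D\<close> is \<open>w\<close>. Then \<open>w\<close> could give
  up one of its two colours (\<open>rainbow_number_less_twice_card\<close>), so each \<open>P\<^sub>i\<close> is non-empty.

  The rest of (ii) comes from the defence condition: each \<open>u\<close> outside \<open>D\<close> has a neighbour \<open>w \<in> D\<close>
  whose guard can move to \<open>u\<close> and leave a dominating set. After this move a private neighbour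
  of \<open>w\<close> other than \<open>u\<close> has lost its only guard, so it must be adjacent to \<open>u\<close>
  (\<open>private_neighbor_adjacent_defended\<close>). When \<open>u\<close> is itself a private neighbour of \<open>w\<close>, this says
  that \<open>P\<^sub>i\<close> is complete. When \<open>u\<close> is nobody's private neighbour, it says that \<open>u\<close> can be put into
  the set \<open>Q\<^sub>i\<close> of any \<open>v\<^sub>i\<close> that defends it.
\<close>

section \<open>Private neighbours and defenders\<close>

definition private_neighbors :: "'a pair_pre_digraph \<Rightarrow> 'a set \<Rightarrow> 'a \<Rightarrow> 'a set" where
  "private_neighbors G D w = {u \<in> pverts G - D. neighbors G u \<inter> D = {w}}"

definition defends :: "'a pair_pre_digraph \<Rightarrow> 'a set \<Rightarrow> 'a \<Rightarrow> 'a \<Rightarrow> bool" where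
  "defends G D w u \<longleftrightarrow> w \<in> neighbors G u \<inter> D \<and> dominating_set G (insert u (D - {w}))"

lemma neighbors_commute:
  assumes "pair_graph G" and "v \<in> neighbors G u"
  shows "u \<in> neighbors G v"
proof -
  interpret pair_graph G by fact
  show ?thesis
    using assms(2) unfolding neighbors_def by (blast intro: arcs_symmetric in_arcsD1)
qed

section \<open>Rainbow domination from a dominating set\<close>

lemma rainbow2_dominatingI:
  assumes range: "\<And>x. x \<in> pverts G \<Longrightarrow> f x \<subseteq> {1, 2}"
    and nb: "\<And>u. u \<in> pverts G \<Longrightarrow> f u = {} \<Longrightarrow> \<exists>x \<in> neighbors G u. f x = {1, 2}"
  shows "rainbow2_dominating G f"
proof -
  have "(\<Union>x \<in> neighbors G u. f x) = {1, 2}" if u: "u \<in> pverts G" "f u = {}" for u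
  proof
    have "neighbors G u \<subseteq> pverts G"
      unfolding neighbors_def by blast
    then show "(\<Union>x \<in> neighbors G u. f x) \<subseteq> {1, 2}"
      using range by blast
    show "{1, 2} \<subseteq> (\<Union>x \<in> neighbors G u. f x)"
      using nb[OF u] by blast
  qed
  then show ?thesis
    using range unfolding rainbow2_dominating_def by blast
qed

lemma rainbow_number_le:
  assumes "rainbow2_dominating G f"
  shows "rainbow2_domination_number G \<le> rainbow_weight G f"
  unfolding rainbow2_domination_number_def using assms by (blast intro: Least_le)

lemma ex_minimum_weak_roman_dominating: "\<exists>g. minimum_weak_roman_dominating G g"
proof -
  have "weak_roman_dominating G (\<lambda>_. 2)"
    by (auto simp: weak_roman_dominating_def)
  then have "\<exists>w g. weak_roman_dominating G g \<and> weak_roman_weight G g = w"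
    by blast
  from LeastI_ex[OF this] show ?thesis
    unfolding minimum_weak_roman_dominating_def weak_roman_number_def .
qed

lemma rainbow_number_le_twice_card:
  assumes "finite (pverts G)" and D: "dominating_set G D"
  shows "rainbow2_domination_number G \<le> 2 * card D"
proof -
  let ?f = "\<lambda>x. if x \<in> D then {1, 2} else {} :: nat set"
  have sub: "D \<subseteq> pverts G"
    using D by (simp add: dominating_set_def)
  have "rainbow2_dominating G ?f"
  proof (rule rainbow2_dominatingI)
    fix u assume "u \<in> pverts G" "?f u = {}"
    then have "u \<in> pverts G - D" by (simp split: if_splits)
    then obtain x where "x \<in> neighbors G u" "x \<in> D"
      using D unfolding dominating_set_def by blast
    then show "\<exists>x \<in> neighbors G u. ?f x = {1, 2}" by (intro bexI[of _ x]) simp_all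
  qed simp
  moreover have "rainbow_weight G ?f = 2 * card D"
  proof -
    have "rainbow_weight G ?f = (\<Sum>x \<in> D. card (?f x))"
      unfolding rainbow_weight_def
      by (rule sum.mono_neutral_right) (use assms(1) sub in auto)
    then show ?thesis by simp
  qed
  ultimately show ?thesis
    using rainbow_number_le[of G ?f] by (simp only:)
qed

text \<open>
  Every vertex outside \<open>D\<close> has a neighbour in \<open>D\<close> other than \<open>w\<close>, and hence sees both colours
  no matter what \<open>w\<close> carries. The vertex \<open>w\<close> keeps one colour only because an empty \<open>w\<close> would
  itself have to be dominated.
\<close>

lemma rainbow_number_less_twice_card:
  assumes "finite (pverts G)" and D: "dominating_set G D"
    and w: "w \<in> D" and empty: "private_neighbors G D w = {}"
  shows "rainbow2_domination_number G < 2 * card D"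
proof -
  let ?f = "\<lambda>x. if x = w then {1} else if x \<in> D then {1, 2} else {} :: nat set"
  have sub: "D \<subseteq> pverts G"
    using D by (simp add: dominating_set_def)
  have fin: "finite D"
    using sub assms(1) by (rule finite_subset)
  have "rainbow2_dominating G ?f"
  proof (rule rainbow2_dominatingI)
    fix u assume "u \<in> pverts G" "?f u = {}"
    then have u: "u \<in> pverts G - D" using w by (simp split: if_splits)
    have "neighbors G u \<inter> D \<noteq> {}"
      using D u unfolding dominating_set_def by blast
    moreover have "neighbors G u \<inter> D \<noteq> {w}"
      using empty u unfolding private_neighbors_def by blast
    ultimately obtain x where "x \<in> neighbors G u" "x \<in> D" "x \<noteq> w"
      by blast
    then show "\<exists>x \<in> neighbors G u. ?f x = {1, 2}" by (intro bexI[of _ x]) simp_all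
  qed simp
  moreover have "rainbow_weight G ?f < 2 * card D"
  proof -
    have "rainbow_weight G ?f = (\<Sum>x \<in> D. card (?f x))"
      unfolding rainbow_weight_def
      by (rule sum.mono_neutral_right) (use assms(1) sub w in auto)
    also have "\<dots> < (\<Sum>x \<in> D. 2)"
      by (rule sum_strict_mono_ex1) (use fin w in auto)
    finally show ?thesis by simp
  qed
  ultimately show ?thesis
    by (rule le_less_trans[OF rainbow_number_le])
qed

section \<open>The defence condition\<close>

lemma dominating_set_support:
  assumes "weak_roman_dominating G g"
  shows "dominating_set G {x \<in> pverts G. g x \<ge> 1}"
  unfolding dominating_set_def
proof (intro conjI ballI)
  fix u assume "u \<in> pverts G - {x \<in> pverts G. g x \<ge> 1}"
  then have "u \<in> pverts G" "g u = 0" by auto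
  then obtain v where "v \<in> neighbors G u" "g v \<ge> 1"
    using assms unfolding weak_roman_dominating_def by blast
  then show "neighbors G u \<inter> {x \<in> pverts G. g x \<ge> 1} \<noteq> {}"
    by (auto simp: neighbors_def)
qed auto

text \<open>
  When all values are at most 1, moving a unit from \<open>w\<close> to \<open>u\<close> empties \<open>w\<close>, so the shifted support
  is obtained by exchanging \<open>w\<close> for \<open>u\<close>. With a value 2 at \<open>w\<close> the guard could stay behind.
\<close>

lemma ex_defender:
  assumes g: "weak_roman_dominating G g" and no2: "\<not> (\<exists>x \<in> pverts G. g x = 2)"
    and u: "u \<in> pverts G" "g u = 0"
  shows "\<exists>w. defends G {x \<in> pverts G. g x = 1} w u"
proof -
  obtain w where w: "w \<in> neighbors G u" "g w \<ge> 1"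
    and dom: "dominating_set G {x \<in> pverts G. shift (\<lambda>y. real (g y)) w u x \<ge> 1}"
    using g u unfolding weak_roman_dominating_def by blast
  have le1: "g x = 0 \<or> g x = 1" if "x \<in> pverts G" for x
    using g no2 that unfolding weak_roman_dominating_def by (auto simp: Pi_iff)
  have "w \<in> pverts G" using w by (simp add: neighbors_def)
  with le1 w have "g w = 1" by fastforce
  have "{x \<in> pverts G. shift (\<lambda>y. real (g y)) w u x \<ge> 1}
      = insert u ({x \<in> pverts G. g x = 1} - {w})"
    using u \<open>g w = 1\<close> le1 by (force simp: shift_def)
  then show ?thesis
    using dom w \<open>w \<in> pverts G\<close> \<open>g w = 1\<close> unfolding defends_def by auto
qed

text \<open>
  Only \<open>u\<close> is new in the exchanged set, so it alone can dominate a vertex whose sole neighbour in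
  \<open>D\<close> was the departed \<open>w\<close>.
\<close>

lemma private_neighbor_adjacent_defended:
  assumes "pair_graph G" and def: "defends G D w u"
    and p: "p \<in> private_neighbors G D w" "p \<noteq> u"
  shows "p \<in> neighbors G u"
proof -
  have "p \<in> pverts G - insert u (D - {w})" and only: "neighbors G p \<inter> D = {w}"
    using p unfolding private_neighbors_def by auto
  then obtain x where "x \<in> neighbors G p" "x \<in> insert u (D - {w})"
    using def unfolding defends_def dominating_set_def by blast
  with only have "u \<in> neighbors G p" by blast
  with assms(1) show ?thesis by (rule neighbors_commute)
qed

text \<open>A private neighbour of \<open>w\<close> can be defended by nobody but \<open>w\<close>.\<close>

lemma complete_set_private_neighbors:
  assumes G: "pair_graph G" and def: "\<And>u. u \<in> pverts G - D \<Longrightarrow> \<exists>w. defends G D w u"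
  shows "complete_set G (private_neighbors G D w)"
  unfolding complete_set_def pairwise_def
proof (intro ballI impI)
  fix u p
  assume u: "u \<in> private_neighbors G D w" and p: "p \<in> private_neighbors G D w" and "u \<noteq> p"
  have "u \<in> pverts G - D" and only: "neighbors G u \<inter> D = {w}"
    using u unfolding private_neighbors_def by auto
  then obtain w' where "defends G D w' u" using def by blast
  moreover from this only have "w' = w" unfolding defends_def by blast
  ultimately show "p \<in> neighbors G u"
    using private_neighbor_adjacent_defended[OF G _ p] \<open>u \<noteq> p\<close> by blast
qed

text \<open>
  A vertex that is not a private neighbour may have several defenders; \<open>s\<close> picks one, which makes
  the sets \<open>Q i\<close> disjoint.
\<close>

lemma private_neighbor_partition:
  fixes v :: "nat \<Rightarrow> 'a"
  assumes G: "pair_graph G" and bij: "bij_betw v {1..k} D"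
    and nonempty: "\<And>w. w \<in> D \<Longrightarrow> private_neighbors G D w \<noteq> {}"
    and def: "\<And>u. u \<in> pverts G - D \<Longrightarrow> \<exists>w. defends G D w u"
  shows "\<exists>P Q.
    (\<Union>i \<in> {1..k}. P i) \<union> (\<Union>i \<in> {1..k}. Q i) = pverts G - D \<and>
    disjoint_family_on P {1..k} \<and>
    disjoint_family_on Q {1..k} \<and>
    (\<forall>i \<in> {1..k}. \<forall>j \<in> {1..k}. P i \<inter> Q j = {}) \<and>
    (\<forall>i \<in> {1..k}.
      P i = {u \<in> pverts G - D. neighbors G u \<inter> D = {v i}} \<and>
      P i \<noteq> {} \<and> complete_set G (P i) \<and>
      (\<forall>q \<in> Q i. \<forall>y \<in> {v i} \<union> P i. y \<in> neighbors G q))"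
proof -
  obtain s where s: "\<And>u. u \<in> pverts G - D \<Longrightarrow> defends G D (s u) u"
    using def by metis
  define P where "P i = private_neighbors G D (v i)" for i
  define R where "R = pverts G - D - (\<Union>i \<in> {1..k}. P i)"
  define Q where "Q i = {u \<in> R. s u = v i}" for i
  have inj: "v i = v j \<longleftrightarrow> i = j" if "i \<in> {1..k}" "j \<in> {1..k}" for i j
    using bij that unfolding bij_betw_def by (metis inj_on_eq_iff)
  have D: "D = v ` {1..k}"
    using bij by (simp add: bij_betw_def)
  have P_sub: "P i \<subseteq> pverts G - D" for i
    unfolding P_def private_neighbors_def by blast
  have "R \<subseteq> (\<Union>i \<in> {1..k}. Q i)"
  proof
    fix u assume "u \<in> R"
    then have "s u \<in> D" using s[of u] unfolding R_def defends_def by blast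
    with \<open>u \<in> R\<close> show "u \<in> (\<Union>i \<in> {1..k}. Q i)" unfolding D Q_def by blast
  qed
  then have cover: "(\<Union>i \<in> {1..k}. P i) \<union> (\<Union>i \<in> {1..k}. Q i) = pverts G - D"
    using P_sub unfolding R_def Q_def by blast
  have disjoint_P: "disjoint_family_on P {1..k}"
    unfolding disjoint_family_on_def P_def private_neighbors_def using inj by blast
  have disjoint_Q: "disjoint_family_on Q {1..k}"
    unfolding disjoint_family_on_def Q_def using inj by auto
  have disjoint_PQ: "P i \<inter> Q j = {}" if "i \<in> {1..k}" for i j
    using that unfolding Q_def R_def by blast
  have P_nonempty: "P i \<noteq> {}" if "i \<in> {1..k}" for i
    unfolding P_def by (rule nonempty) (use that D in blast)
  have P_complete: "complete_set G (P i)" for i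
    unfolding P_def using G def by (rule complete_set_private_neighbors)
  have Q_adjacent: "y \<in> neighbors G q"
    if i: "i \<in> {1..k}" and q: "q \<in> Q i" and y: "y \<in> {v i} \<union> P i" for i q y
  proof -
    have q_def: "defends G D (v i) q"
      using q s[of q] unfolding Q_def R_def by auto
    show ?thesis
    proof (cases "y = v i")
      case True
      then show ?thesis using q_def unfolding defends_def by blast
    next
      case False
      with y have "y \<in> P i" by blast
      moreover have "y \<noteq> q" using q i \<open>y \<in> P i\<close> unfolding Q_def R_def by blast
      ultimately show ?thesis
        using private_neighbor_adjacent_defended[OF G q_def] unfolding P_def by blast
    qed
  qed
  have P_eq: "P i = {u \<in> pverts G - D. neighbors G u \<inter> D = {v i}}" for i
    by (simp add: P_def private_neighbors_def)
  show ?thesis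
  proof (rule exI[of _ P], rule exI[of _ Q], intro conjI ballI)
    fix i assume "i \<in> {1..k}"
    then show "P i \<noteq> {}" by (rule P_nonempty)
    fix q y assume "q \<in> Q i" "y \<in> {v i} \<union> P i"
    with \<open>i \<in> {1..k}\<close> show "y \<in> neighbors G q" by (rule Q_adjacent)
  qed (rule cover disjoint_P disjoint_Q disjoint_PQ P_eq P_complete | assumption)+
qed

section \<open>The inequality and the case of equality\<close>

theorem theorem1:
  fixes G :: "'a pair_pre_digraph"
  assumes "pair_graph G"
  shows "rainbow2_domination_number G \<le> 2 * weak_roman_number G \<and>
    (\<forall>g. rainbow2_domination_number G = 2 * weak_roman_number G \<and>
         minimum_weak_roman_dominating G g \<longrightarrow>
      (\<not> (\<exists>x \<in> pverts G. g x = 2)) \<and>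
      (\<forall>V1 (k::nat) v. V1 = {x \<in> pverts G. g x = 1} \<and> bij_betw v {1..k} V1 \<longrightarrow>
        (\<exists>P Q.
          (\<Union>i \<in> {1..k}. P i) \<union> (\<Union>i \<in> {1..k}. Q i) = pverts G - V1 \<and>
          disjoint_family_on P {1..k} \<and>
          disjoint_family_on Q {1..k} \<and>
          (\<forall>i \<in> {1..k}. \<forall>j \<in> {1..k}. P i \<inter> Q j = {}) \<and>
          (\<forall>i \<in> {1..k}.
            P i = {u \<in> pverts G - V1. neighbors G u \<inter> V1 = {v i}} \<and>
            P i \<noteq> {} \<and> complete_set G (P i) \<and>
            (\<forall>q \<in> Q i. \<forall>y \<in> {v i} \<union> P i. y \<in> neighbors G q)))))"
proof (intro conjI allI impI)
  interpret pair_graph G by fact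
  have fin: "finite (pverts G)" by (rule pair_finite_verts)
  have card_le: "card {x \<in> pverts G. g x \<ge> 1} \<le> weak_roman_weight G g" for g
  proof -
    have "card {x \<in> pverts G. g x \<ge> 1} = (\<Sum>x \<in> {x \<in> pverts G. g x \<ge> 1}. 1)"
      by simp
    also have "\<dots> \<le> (\<Sum>x \<in> {x \<in> pverts G. g x \<ge> 1}. g x)"
      by (rule sum_mono) auto
    also have "\<dots> \<le> weak_roman_weight G g"
      unfolding weak_roman_weight_def by (rule sum_mono2) (use fin in auto)
    finally show ?thesis .
  qed
  obtain h where h: "minimum_weak_roman_dominating G h"
    using ex_minimum_weak_roman_dominating by blast
  then show "rainbow2_domination_number G \<le> 2 * weak_roman_number G"
    using rainbow_number_le_twice_card[OF fin dominating_set_support[of G h]] card_le[of h]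
    unfolding minimum_weak_roman_dominating_def by simp

  fix g
  assume "rainbow2_domination_number G = 2 * weak_roman_number G \<and>
    minimum_weak_roman_dominating G g"
  then have eq: "rainbow2_domination_number G = 2 * weak_roman_weight G g"
    and g: "weak_roman_dominating G g"
    unfolding minimum_weak_roman_dominating_def by simp_all
  note support_dom = dominating_set_support[OF g]
  \<comment> \<open>Equality forces both estimates above to be sharp for \<open>g\<close>: its weight is the size of its support.\<close>
  have tight: "weak_roman_weight G g = card {x \<in> pverts G. g x \<ge> 1}"
    using rainbow_number_le_twice_card[OF fin support_dom] card_le[of g] eq by simp
  show no2: "\<not> (\<exists>x \<in> pverts G. g x = 2)"
  proof
    assume "\<exists>x \<in> pverts G. g x = 2"
    then obtain x where "x \<in> pverts G" "g x = 2" by blast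
    then have "card {x \<in> pverts G. g x \<ge> 1} < (\<Sum>x \<in> {x \<in> pverts G. g x \<ge> 1}. g x)"
      unfolding card_eq_sum
      by (intro sum_strict_mono_ex1 bexI[of _ x]) (use fin in auto)
    also have "\<dots> \<le> weak_roman_weight G g"
      unfolding weak_roman_weight_def by (rule sum_mono2) (use fin in auto)
    finally show False using tight by simp
  qed

  fix V1 and k :: nat and v
  assume "V1 = {x \<in> pverts G. g x = 1} \<and> bij_betw v {1..k} V1"
  then have V1: "V1 = {x \<in> pverts G. g x = 1}" and bij: "bij_betw v {1..k} V1"
    by blast+
  have le1: "g x = 0 \<or> g x = 1" if "x \<in> pverts G" for x
    using g no2 that unfolding weak_roman_dominating_def by (auto simp: Pi_iff)
  then have V1_support: "V1 = {x \<in> pverts G. g x \<ge> 1}"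
    unfolding V1 by force
  have nonempty: "private_neighbors G V1 w \<noteq> {}" if "w \<in> V1" for w
    using rainbow_number_less_twice_card[OF fin, of V1 w] support_dom that eq tight
    unfolding V1_support by force
  have defended: "\<exists>w. defends G V1 w u" if "u \<in> pverts G - V1" for u
    unfolding V1 by (rule ex_defender[OF g no2]) (use that le1 V1 in auto)
  from private_neighbor_partition[OF assms bij nonempty defended]
  show "\<exists>P Q.
      (\<Union>i \<in> {1..k}. P i) \<union> (\<Union>i \<in> {1..k}. Q i) = pverts G - V1 \<and>
      disjoint_family_on P {1..k} \<and>
      disjoint_family_on Q {1..k} \<and>
      (\<forall>i \<in> {1..k}. \<forall>j \<in> {1..k}. P i \<inter> Q j = {}) \<and>
      (\<forall>i \<in> {1..k}.
        P i = {u \<in> pverts G - V1. neighbors G u \<inter> V1 = {v i}} \<and>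
        P i \<noteq> {} \<and> complete_set G (P i) \<and>
        (\<forall>q \<in> Q i. \<forall>y \<in> {v i} \<union> P i. y \<in> neighbors G q))" .
qed

end
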